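(* Suppose $\mathcal A, \mathcal B, \mathcal C$ and $\mathcal D$ are collections of sets. Suppose that for every $n\in\omega$ there are functions $\overleftarrow{R}_{\mathrm{I},n}:\mathcal B \to \mathcal P(\mathcal A)$ and $\overrightarrow{R}_{\mathrm{II},n}:\left(\bigcup \mathcal A\right) \times \mathcal A \times \mathcal B \to \bigcup \mathcal B$ so that: (R1) for all $n \in \omega$ and $B \in \mathcal B$, $\overleftarrow{R}_{\mathrm{I},n}(B) \neq \emptyset$; (R2) for all $n\in\omega$, whenever $B\in\mathcal B$ and $x \in A \in \overleftarrow{R}_{\mathrm{I},n}(B)$, then $\overrightarrow{R}_{\mathrm{II},n}(x,A,B) \in B$; and (R3) whenever, for each $n\in\omega$, $B_n\in\mathcal B$, $A_n \in \overleftarrow{R}_{\mathrm{I},n}(B_n)$ and $F_n \subseteq A_n$ is finite, and $\bigcup_{n\in\omega} F_n \in \mathcal C$, then \[ \left\{\overrightarrow{R}_{\mathrm{II},n}(x,A_n,B_n) : n \in \omega \text{ and } x \in F_n \right\} \in \mathcal D. \] Then $\mathsf G_\square(\mathcal A, \mathcal C) \leq_{\mathrm{II}} \mathsf G_\square(\mathcal B, \mathcal D)$ for each $\square\in\{1,\mathrm{fin}\}$. If, in addition, $\overleftarrow{R}_{\mathrm{I},1} = \overleftarrow{R}_{\mathrm{I},n}$ for all $n \in \omega$, then $\mathsf G_\square(\mathcal A, \mathcal C) \leq^+_{\mathrm{II}} \mathsf G_\square(\mathcal B, \mathcal D)$ for each $\square\in\{1,\mathrm{fin}\}$.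
   Context: Selection games. For collections $\mathcal A,\mathcal B$ of sets, in $\mathsf G_1(\mathcal A,\mathcal B)$ in round $n\in\omega$ player One plays $A_n\in\mathcal A$ and player Two responds with $x_n\in A_n$; Two wins iff $\{x_n:n\in\omega\}\in\mathcal B$. In $\mathsf G_{\mathrm{fin}}(\mathcal A,\mathcal B)$ Two instead plays a finite $\mathcal F_n\subseteq A_n$ and wins iff $\bigcup_n\mathcal F_n\in\mathcal B$. Otherwise One wins. Strategies. A strategy for One is a function from finite sequences of Two's moves to One's moves; it is predetermined if it depends only on the round number, and constant if it always plays one fixed element. A strategy for Two is a function assigning to each nonempty finite sequence of One's moves a legal response to the last one; it is Markov if it depends only on One's most recent move and the round number. A strategy is winning if its player wins every play following it. $\mathrm I\uparrow$, $\mathrm I\underset{\mathrm{pre}}{\uparrow}$, $\mathrm I\underset{\mathrm{cnst}}{\uparrow}$, $\mathrm{II}\uparrow$, $\mathrm{II}\underset{\mathrm{mark}}{\uparrow}$ denote existence of a winning strategy of the given kind, and $\not\uparrow$ the negation. Order. $\mathcal G\leq_{\mathrm{II}}\mathcal H$ means: $\mathrm{II}\underset{\mathrm{mark}}{\uparrow}\mathcal G\Rightarrow\mathrm{II}\underset{\mathrm{mark}}{\uparrow}\mathcal H$; $\mathrm{II}\uparrow\mathcal G\Rightarrow\mathrm{II}\uparrow\mathcal H$; $\mathrm I\not\uparrow\mathcal G\Rightarrow\mathrm I\not\uparrow\mathcal H$; and $\mathrm I\underset{\mathrm{pre}}{\not\uparrow}\mathcal G\Rightarrow\mathrm I\underset{\mathrm{pre}}{\not\uparrow}\mathcal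 H$. $\mathcal G\leq^+_{\mathrm{II}}\mathcal H$ means that in addition $\mathrm I\underset{\mathrm{cnst}}{\not\uparrow}\mathcal G\Rightarrow\mathrm I\underset{\mathrm{cnst}}{\not\uparrow}\mathcal H$. *)

theory Defs
  imports Main "HOL-Library.FuncSet"
begin

text \<open>
  Games of length \<open>\<omega>\<close> in which, in each round, One plays an element of \<open>One_moves\<close> and Two
  answers with an element of \<open>replies\<close> of that move. Two wins a complete play iff the sequence
  of her moves lies in \<open>Two_wins\<close>. A play in which Two is left without a reply is lost for Two.
\<close>

record ('p, 'q) game =
  One_moves :: "'p set"
  replies :: "'p \<Rightarrow> 'q set"
  Two_wins :: "(nat \<Rightarrow> 'q) set"

definition G_1 :: "'a set set \<Rightarrow> 'a set set \<Rightarrow> ('a set, 'a) game" where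
  "G_1 \<A> \<B> = \<lparr> One_moves = \<A>, replies = (\<lambda>A. A), Two_wins = {x. range x \<in> \<B>} \<rparr>"

definition G_fin :: "'a set set \<Rightarrow> 'a set set \<Rightarrow> ('a set, 'a set) game" where
  "G_fin \<A> \<B> =
    \<lparr> One_moves = \<A>, replies = (\<lambda>A. {F. finite F \<and> F \<subseteq> A}), Two_wins = {F. (\<Union>n. F n) \<in> \<B>} \<rparr>"

definition Two_moves :: "('p, 'q) game \<Rightarrow> 'q set" where
  "Two_moves G = (\<Union>A \<in> One_moves G. replies G A)"

text \<open>
  Strategies are total functions on lists, constrained only on the sequences of moves on which a
  strategy is defined; their values elsewhere are irrelevant.
\<close>

definition One_strategy :: "('p, 'q) game \<Rightarrow> ('q list \<Rightarrow> 'p) \<Rightarrow> bool" where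
  "One_strategy G \<sigma> \<longleftrightarrow> (\<forall>s \<in> lists (Two_moves G). \<sigma> s \<in> One_moves G)"

definition predetermined_One :: "('p, 'q) game \<Rightarrow> ('q list \<Rightarrow> 'p) \<Rightarrow> bool" where
  "predetermined_One G \<sigma> \<longleftrightarrow> (\<exists>f. \<forall>s \<in> lists (Two_moves G). \<sigma> s = f (length s))"

definition constant_One :: "('p, 'q) game \<Rightarrow> ('q list \<Rightarrow> 'p) \<Rightarrow> bool" where
  "constant_One G \<sigma> \<longleftrightarrow> (\<exists>c. \<forall>s \<in> lists (Two_moves G). \<sigma> s = c)"

definition One_winning :: "('p, 'q) game \<Rightarrow> ('q list \<Rightarrow> 'p) \<Rightarrow> bool" where
  "One_winning G \<sigma> \<longleftrightarrow>
    (\<forall>y. (\<forall>n. y n \<in> replies G (\<sigma> (map y [0..<n]))) \<longrightarrow> y \<notin> Two_wins G)"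

definition Two_strategy :: "('p, 'q) game \<Rightarrow> ('p list \<Rightarrow> 'q) \<Rightarrow> bool" where
  "Two_strategy G \<tau> \<longleftrightarrow> (\<forall>s \<in> lists (One_moves G). s \<noteq> [] \<longrightarrow> \<tau> s \<in> replies G (last s))"

text \<open>Rounds are numbered from \<open>0\<close>, so Two answers \<open>s\<close> in round \<open>length s - 1\<close>.\<close>

definition Markov_Two :: "('p, 'q) game \<Rightarrow> ('p list \<Rightarrow> 'q) \<Rightarrow> bool" where
  "Markov_Two G \<tau> \<longleftrightarrow>
    (\<exists>f. \<forall>s \<in> lists (One_moves G). s \<noteq> [] \<longrightarrow> \<tau> s = f (last s) (length s - 1))"

definition Two_winning :: "('p, 'q) game \<Rightarrow> ('p list \<Rightarrow> 'q) \<Rightarrow> bool" where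
  "Two_winning G \<tau> \<longleftrightarrow>
    (\<forall>p. (\<forall>n. p n \<in> One_moves G) \<longrightarrow> (\<lambda>n. \<tau> (map p [0..<Suc n])) \<in> Two_wins G)"

definition One_has_win :: "('p, 'q) game \<Rightarrow> bool" where
  "One_has_win G \<longleftrightarrow> (\<exists>\<sigma>. One_strategy G \<sigma> \<and> One_winning G \<sigma>)"

definition One_has_win_pre :: "('p, 'q) game \<Rightarrow> bool" where
  "One_has_win_pre G \<longleftrightarrow> (\<exists>\<sigma>. One_strategy G \<sigma> \<and> predetermined_One G \<sigma> \<and> One_winning G \<sigma>)"

definition One_has_win_cnst :: "('p, 'q) game \<Rightarrow> bool" where
  "One_has_win_cnst G \<longleftrightarrow> (\<exists>\<sigma>. One_strategy G \<sigma> \<and> constant_One G \<sigma> \<and> One_winning G \<sigma>)"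

definition Two_has_win :: "('p, 'q) game \<Rightarrow> bool" where
  "Two_has_win G \<longleftrightarrow> (\<exists>\<tau>. Two_strategy G \<tau> \<and> Two_winning G \<tau>)"

definition Two_has_win_mark :: "('p, 'q) game \<Rightarrow> bool" where
  "Two_has_win_mark G \<longleftrightarrow> (\<exists>\<tau>. Two_strategy G \<tau> \<and> Markov_Two G \<tau> \<and> Two_winning G \<tau>)"

definition le_II :: "('p, 'q) game \<Rightarrow> ('r, 's) game \<Rightarrow> bool"
    (infix "\<le>\<^sub>I\<^sub>I" 50) where
  "G \<le>\<^sub>I\<^sub>I H \<longleftrightarrow>
    (Two_has_win_mark G \<longrightarrow> Two_has_win_mark H) \<and>
    (Two_has_win G \<longrightarrow> Two_has_win H) \<and>
    (\<not> One_has_win G \<longrightarrow> \<not> One_has_win H) \<and>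
    (\<not> One_has_win_pre G \<longrightarrow> \<not> One_has_win_pre H)"

definition le_II_plus :: "('p, 'q) game \<Rightarrow> ('r, 's) game \<Rightarrow> bool"
    (infix "\<le>\<^sub>I\<^sub>I\<^sup>+" 50) where
  "G \<le>\<^sub>I\<^sub>I\<^sup>+ H \<longleftrightarrow>
    G \<le>\<^sub>I\<^sub>I H \<and> (\<not> One_has_win_cnst G \<longrightarrow> \<not> One_has_win_cnst H)"

end

theory Submission
  imports Defs
begin

text \<open>
  Let \<open>G\<close> be the game on \<open>\<A>, \<C>\<close> and \<open>H\<close> the game on \<open>\<B>, \<D>\<close>. Choose \<open>r n B \<in> RI n B\<close>. Two plays \<open>H\<close> by pretending that One's move \<open>B\<close> in round \<open>n\<close> was the
  move \<open>r n B\<close> of \<open>G\<close>, and translating her reply in \<open>G\<close> back through \<open>RII n\<close>. Dually, One plays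
  \<open>G\<close> by running his winning strategy for \<open>H\<close> against the translated replies of Two. Both single
  and finite selections are instances of such a round-by-round translation.
\<close>

section \<open>Normal forms for One's winning strategies\<close>

lemma Two_strategyD:
  "Two_strategy G \<tau> \<Longrightarrow> s \<in> lists (One_moves G) \<Longrightarrow> s \<noteq> [] \<Longrightarrow> \<tau> s \<in> replies G (last s)"
  by (simp add: Two_strategy_def)

text \<open>Legality of all values of \<open>\<sigma>'\<close> keeps every play that follows it
  inside \<open>Two_moves G\<close>, so only histories occur on which the two strategies
  agree.\<close>

lemma One_winning_cong:
  assumes "One_winning G \<sigma>" and total: "\<And>s. \<sigma>' s \<in> One_moves G"
    and eq: "\<And>s. s \<in> lists (Two_moves G) \<Longrightarrow> \<sigma>' s = \<sigma> s"
  shows "One_winning G \<sigma>'"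
  unfolding One_winning_def
proof (intro allI impI)
  fix y assume y: "\<forall>n. y n \<in> replies G (\<sigma>' (map y [0..<n]))"
  have "y n \<in> Two_moves G" for n
    using y total unfolding Two_moves_def by blast
  then have "\<sigma>' (map y [0..<n]) = \<sigma> (map y [0..<n])" for n
    by (intro eq) auto
  with y assms(1) show "y \<notin> Two_wins G"
    by (simp add: One_winning_def)
qed

text \<open>Totality removes the side condition on histories, so a strategy may be fed arbitrary
  lists in the constructions below.\<close>

lemma One_has_win_iff:
  "One_has_win G \<longleftrightarrow> (\<exists>\<sigma>. (\<forall>s. \<sigma> s \<in> One_moves G) \<and> One_winning G \<sigma>)"
proof
  assume "One_has_win G"
  then obtain \<sigma> where \<sigma>: "One_strategy G \<sigma>" "One_winning G \<sigma>"
    by (auto simp: One_has_win_def)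
  \<comment> \<open>The opening move \<open>\<sigma> []\<close> serves as default: it is legal
    because the empty history is.\<close>
  define \<sigma>' where "\<sigma>' s = (if s \<in> lists (Two_moves G) then \<sigma> s else \<sigma> [])" for s
  have total: "\<sigma>' s \<in> One_moves G" for s
    using \<sigma>(1) by (simp add: \<sigma>'_def One_strategy_def)
  have "One_winning G \<sigma>'"
    using \<sigma>(2) total by (rule One_winning_cong) (simp add: \<sigma>'_def)
  with total show "\<exists>\<sigma>. (\<forall>s. \<sigma> s \<in> One_moves G) \<and> One_winning G \<sigma>"
    by blast
qed (auto simp: One_has_win_def One_strategy_def)

lemma One_has_win_pre_iff:
  "One_has_win_pre G \<longleftrightarrow>
    (\<exists>f. (\<forall>n. f n \<in> One_moves G) \<and> One_winning G (\<lambda>s. f (length s)))"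
proof
  assume "One_has_win_pre G"
  then obtain \<sigma> f where \<sigma>: "One_strategy G \<sigma>" "One_winning G \<sigma>"
    and f: "\<And>s. s \<in> lists (Two_moves G) \<Longrightarrow> \<sigma> s = f (length s)"
    unfolding One_has_win_pre_def predetermined_One_def by blast
  \<comment> \<open>If Two has no moves at all, then \<open>f\<close> is only meaningful in round \<open>0\<close>.\<close>
  define f' where
    "f' n = (if \<exists>s\<in>lists (Two_moves G). length s = n then f n else \<sigma> [])" for n
  have total: "f' n \<in> One_moves G" for n
    using \<sigma>(1) f unfolding f'_def One_strategy_def by (metis lists.Nil)
  have "One_winning G (\<lambda>s. f' (length s))"
    using \<sigma>(2) total by (rule One_winning_cong) (auto simp: f'_def f)
  with total show "\<exists>f. (\<forall>n. f n \<in> One_moves G) \<and> One_winning G (\<lambda>s. f (length s))"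
    by blast
next
  assume "\<exists>f. (\<forall>n. f n \<in> One_moves G) \<and> One_winning G (\<lambda>s. f (length s))"
  then obtain f where "\<And>n. f n \<in> One_moves G" "One_winning G (\<lambda>s. f (length s))"
    by blast
  then show "One_has_win_pre G"
    unfolding One_has_win_pre_def One_strategy_def predetermined_One_def
    by (intro exI[of _ "\<lambda>s. f (length s)"]) blast
qed

lemma One_has_win_cnst_iff:
  "One_has_win_cnst G \<longleftrightarrow> (\<exists>c\<in>One_moves G. One_winning G (\<lambda>_. c))"
proof
  assume "One_has_win_cnst G"
  then obtain \<sigma> c where \<sigma>: "One_strategy G \<sigma>" "One_winning G \<sigma>"
    and c: "\<And>s. s \<in> lists (Two_moves G) \<Longrightarrow> \<sigma> s = c"
    unfolding One_has_win_cnst_def constant_One_def by blast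
  \<comment> \<open>The empty history is available even when Two has no moves, so \<open>c\<close>
    equals the legal opening move.\<close>
  have "c \<in> One_moves G"
    using \<sigma>(1) c[of "[]"] by (force simp: One_strategy_def)
  moreover from this have "One_winning G (\<lambda>_. c)"
    using c by (intro One_winning_cong[OF \<sigma>(2)]) auto
  ultimately show "\<exists>c\<in>One_moves G. One_winning G (\<lambda>_. c)"
    by blast
next
  assume "\<exists>c\<in>One_moves G. One_winning G (\<lambda>_. c)"
  then obtain c where "c \<in> One_moves G" "One_winning G (\<lambda>_. c)"
    by blast
  then show "One_has_win_cnst G"
    unfolding One_has_win_cnst_def One_strategy_def constant_One_def
    by (intro exI[of _ "\<lambda>_. c"]) blast
qed

section \<open>Translations between games and the transfer of Two's strategies\<close>

text \<open>The maps read only the round number and the current moves, never the history; this is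
  why strategies with limited information stay limited. \<open>t\<close> also receives One's move in
  \<open>H\<close>, from which \<open>r\<close> recovers his move in \<open>G\<close>.\<close>

locale game_translation =
  fixes G :: "('p, 'q) game" and H :: "('r, 's) game"
    and r :: "nat \<Rightarrow> 'r \<Rightarrow> 'p" and t :: "nat \<Rightarrow> 'r \<Rightarrow> 'q \<Rightarrow> 's"
  assumes r: "B \<in> One_moves H \<Longrightarrow> r n B \<in> One_moves G"
    and t: "B \<in> One_moves H \<Longrightarrow> x \<in> replies G (r n B) \<Longrightarrow> t n B x \<in> replies H B"
    and wins: "(\<And>n. b n \<in> One_moves H) \<Longrightarrow> (\<And>n. y n \<in> replies G (r n (b n))) \<Longrightarrow>
      y \<in> Two_wins G \<Longrightarrow> (\<lambda>n. t n (b n) (y n)) \<in> Two_wins H"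
begin

definition moves_to_G :: "'r list \<Rightarrow> 'p list" where
  "moves_to_G s = map (\<lambda>i. r i (s ! i)) [0..<length s]"

lemma moves_to_G_in_lists: "s \<in> lists (One_moves H) \<Longrightarrow> moves_to_G s \<in> lists (One_moves G)"
  by (auto simp: moves_to_G_def intro!: r)

lemma length_moves_to_G [simp]: "length (moves_to_G s) = length s"
  by (simp add: moves_to_G_def)

lemma moves_to_G_eq_Nil_iff [simp]: "moves_to_G s = [] \<longleftrightarrow> s = []"
  by (simp flip: length_0_conv)

lemma last_moves_to_G: "s \<noteq> [] \<Longrightarrow> last (moves_to_G s) = r (length s - 1) (last s)"
  by (simp add: last_conv_nth) (simp add: moves_to_G_def)

lemma moves_to_G_map: "moves_to_G (map p [0..<n]) = map (\<lambda>i. r i (p i)) [0..<n]"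
  by (simp add: moves_to_G_def)

definition Two_to_H :: "('p list \<Rightarrow> 'q) \<Rightarrow> 'r list \<Rightarrow> 's" where
  "Two_to_H \<tau> s = t (length s - 1) (last s) (\<tau> (moves_to_G s))"

lemma Two_strategy_Two_to_H:
  assumes "Two_strategy G \<tau>"
  shows "Two_strategy H (Two_to_H \<tau>)"
  unfolding Two_strategy_def
proof (intro ballI impI)
  fix s assume s: "s \<in> lists (One_moves H)" "s \<noteq> []"
  have "\<tau> (moves_to_G s) \<in> replies G (r (length s - 1) (last s))"
    using Two_strategyD[OF assms moves_to_G_in_lists[OF s(1)]] s(2)
    by (simp add: last_moves_to_G)
  moreover have "last s \<in> One_moves H"
    using s by auto
  ultimately show "Two_to_H \<tau> s \<in> replies H (last s)"
    by (simp add: Two_to_H_def t)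
qed

lemma Two_winning_Two_to_H:
  assumes "Two_strategy G \<tau>" "Two_winning G \<tau>"
  shows "Two_winning H (Two_to_H \<tau>)"
  unfolding Two_winning_def
proof (intro allI impI)
  fix p :: "nat \<Rightarrow> 'r"
  assume p: "\<forall>n. p n \<in> One_moves H"
  define p' where "p' i = r i (p i)" for i
  define y where "y n = \<tau> (map p' [0..<Suc n])" for n
  have p': "p' n \<in> One_moves G" for n
    using p by (simp add: p'_def r)
  have "map p' [0..<Suc n] \<in> lists (One_moves G)" for n
    using p' by (simp only: in_lists_conv_set) auto
  \<comment> \<open>\<open>Two_winning\<close> speaks only of the outcome; \<open>wins\<close> also
    needs legal replies, and these come from \<open>Two_strategy\<close>.\<close>
  then have "y n \<in> replies G (last (map p' [0..<Suc n]))" for n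
    unfolding y_def by (rule Two_strategyD[OF assms(1)]) simp
  then have "y n \<in> replies G (r n (p n))" for n
    by (simp add: p'_def)
  moreover have "y \<in> Two_wins G"
    using assms(2) p' unfolding y_def Two_winning_def by blast
  ultimately have "(\<lambda>n. t n (p n) (y n)) \<in> Two_wins H"
    using p by (intro wins) auto
  moreover have "Two_to_H \<tau> (map p [0..<Suc n]) = t n (p n) (y n)" for n
    unfolding Two_to_H_def moves_to_G_map y_def p'_def by simp
  ultimately show "(\<lambda>n. Two_to_H \<tau> (map p [0..<Suc n])) \<in> Two_wins H"
    by simp
qed

text \<open>The last entry of the translated history is determined by the last move and the round,
  and \<open>f\<close> sees nothing else.\<close>

lemma Markov_Two_Two_to_H:
  assumes "Markov_Two G \<tau>"
  shows "Markov_Two H (Two_to_H \<tau>)"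
proof -
  from assms obtain f where
    f: "\<And>s. s \<in> lists (One_moves G) \<Longrightarrow> s \<noteq> [] \<Longrightarrow> \<tau> s = f (last s) (length s - 1)"
    unfolding Markov_Two_def by blast
  have "Two_to_H \<tau> s = t (length s - 1) (last s) (f (r (length s - 1) (last s)) (length s - 1))"
    if "s \<in> lists (One_moves H)" "s \<noteq> []" for s
    using that by (simp add: Two_to_H_def f[OF moves_to_G_in_lists] last_moves_to_G)
  then show ?thesis
    unfolding Markov_Two_def
    by (intro exI[of _ "\<lambda>B n. t n B (f (r n B) n)"]) simp
qed

lemma Two_has_win_transfer: "Two_has_win G \<Longrightarrow> Two_has_win H"
  unfolding Two_has_win_def using Two_strategy_Two_to_H Two_winning_Two_to_H by blast

lemma Two_has_win_mark_transfer: "Two_has_win_mark G \<Longrightarrow> Two_has_win_mark H"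
  unfolding Two_has_win_mark_def
  using Two_strategy_Two_to_H Two_winning_Two_to_H Markov_Two_Two_to_H by blast

section \<open>Transfer of One's strategies\<close>

text \<open>\<open>lift\<close> shadows each sequence \<open>y\<close> of Two's moves in
  \<open>G\<close> by a sequence \<open>z\<close> in \<open>H\<close> played against
  \<open>\<sigma>\<close>. If a legal \<open>y\<close> won for Two, then by \<open>wins\<close> so
  would \<open>z\<close>, a legal play against the winning strategy \<open>\<sigma>\<close>.
  Isolating \<open>lift\<close> lets general, predetermined and constant strategies share this
  argument.\<close>

lemma One_winning_pullback:
  assumes "One_winning H \<sigma>" and total: "\<And>s. \<sigma> s \<in> One_moves H"
    and lift: "\<And>y. \<exists>z. \<forall>n. \<sigma>' (map y [0..<n]) = r n (\<sigma> (map z [0..<n])) \<and>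
      z n = t n (\<sigma> (map z [0..<n])) (y n)"
  shows "One_winning G \<sigma>'"
  unfolding One_winning_def
proof (intro allI impI notI)
  fix y assume y: "\<forall>n. y n \<in> replies G (\<sigma>' (map y [0..<n]))" and win: "y \<in> Two_wins G"
  from lift obtain z where
    \<sigma>': "\<And>n. \<sigma>' (map y [0..<n]) = r n (\<sigma> (map z [0..<n]))" and
    z: "\<And>n. z n = t n (\<sigma> (map z [0..<n])) (y n)"
    by metis
  define b where "b n = \<sigma> (map z [0..<n])" for n
  have y': "y n \<in> replies G (r n (b n))" for n
    using y by (simp add: \<sigma>' b_def)
  have b: "b n \<in> One_moves H" for n
    by (simp add: b_def total)
  have z': "z = (\<lambda>n. t n (b n) (y n))"
    unfolding b_def by (rule ext) (rule z)
  have "z n \<in> replies H (\<sigma> (map z [0..<n]))" for n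
    using t[OF b y'] by (subst z) (simp add: b_def)
  then have "z \<notin> Two_wins H"
    using assms(1) by (simp add: One_winning_def)
  moreover have "z \<in> Two_wins H"
    unfolding z' using b y' win by (rule wins)
  ultimately show False ..
qed

text \<open>The list of Two's moves in \<open>G\<close> is processed latest move first.\<close>

primrec replies_to_H :: "('s list \<Rightarrow> 'r) \<Rightarrow> 'q list \<Rightarrow> 's list" where
  "replies_to_H \<sigma> [] = []"
| "replies_to_H \<sigma> (x # s) =
    replies_to_H \<sigma> s @ [t (length s) (\<sigma> (replies_to_H \<sigma> s)) x]"

lemma One_has_win_transfer:
  assumes "One_has_win H"
  shows "One_has_win G"
proof -
  from assms obtain \<sigma> where \<sigma>: "\<And>s. \<sigma> s \<in> One_moves H" "One_winning H \<sigma>"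
    by (auto simp: One_has_win_iff)
  define \<sigma>' where "\<sigma>' s = r (length s) (\<sigma> (replies_to_H \<sigma> (rev s)))" for s
  have "One_winning G \<sigma>'"
  proof (rule One_winning_pullback[OF \<sigma>(2,1)])
    fix y
    \<comment> \<open>Reading \<open>z\<close> off \<open>replies_to_H\<close> avoids defining it by
      recursion on all its earlier values; the induction then identifies its prefixes with the
      computed histories.\<close>
    define z where "z n = t n (\<sigma> (replies_to_H \<sigma> (rev (map y [0..<n])))) (y n)" for n
    have "replies_to_H \<sigma> (rev (map y [0..<n])) = map z [0..<n]" for n
      by (induction n) (simp_all add: z_def)
    then show "\<exists>z. \<forall>n. \<sigma>' (map y [0..<n]) = r n (\<sigma> (map z [0..<n])) \<and>
        z n = t n (\<sigma> (map z [0..<n])) (y n)"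
      by (intro exI[of _ z]) (simp add: \<sigma>'_def, simp add: z_def)
  qed
  moreover have "\<sigma>' s \<in> One_moves G" for s
    by (simp add: \<sigma>'_def r \<sigma>(1))
  ultimately show ?thesis
    by (auto simp: One_has_win_iff)
qed

lemma One_has_win_pre_transfer:
  assumes "One_has_win_pre H"
  shows "One_has_win_pre G"
proof -
  from assms obtain f where f: "\<And>n. f n \<in> One_moves H" "One_winning H (\<lambda>s. f (length s))"
    unfolding One_has_win_pre_iff by blast
  have "One_winning G (\<lambda>s. r (length s) (f (length s)))"
    \<comment> \<open>The strategy sees only the length of the history, so
      \<open>z n = t n (f n) (y n)\<close> is explicit.\<close>
    by (rule One_winning_pullback[OF f(2,1)]) auto
  then show ?thesis
    unfolding One_has_win_pre_iff using r f(1)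
    by (intro exI[of _ "\<lambda>n. r n (f n)"]) simp
qed

text \<open>A constant \<open>c\<close> is translated to the moves \<open>r n c\<close>, which may
  vary with the round; \<open>const\<close> makes them a single move.\<close>

lemma One_has_win_cnst_transfer:
  assumes const: "\<And>n B. B \<in> One_moves H \<Longrightarrow> r n B = r 0 B" and "One_has_win_cnst H"
  shows "One_has_win_cnst G"
proof -
  from assms(2) obtain c where c: "c \<in> One_moves H" "One_winning H (\<lambda>_. c)"
    by (auto simp: One_has_win_cnst_iff)
  have "One_winning G (\<lambda>_. r 0 c)"
    by (rule One_winning_pullback[OF c(2,1)]) (auto simp: const[OF c(1), symmetric])
  then show ?thesis
    unfolding One_has_win_cnst_iff using r[OF c(1)] by blast
qed

lemma le_II: "G \<le>\<^sub>I\<^sub>I H"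
  unfolding le_II_def
  using Two_has_win_transfer Two_has_win_mark_transfer One_has_win_transfer
    One_has_win_pre_transfer by blast

lemma le_II_plus:
  assumes "\<And>n B. B \<in> One_moves H \<Longrightarrow> r n B = r 0 B"
  shows "G \<le>\<^sub>I\<^sub>I\<^sup>+ H"
  unfolding le_II_plus_def using le_II One_has_win_cnst_transfer[OF assms] by blast

end

section \<open>Selection games as instances of the translation\<close>

theorem theorem2p17:
  fixes \<A> \<C> :: "'a set set" and \<B> \<D> :: "'b set set"
    and RI :: "nat \<Rightarrow> 'b set \<Rightarrow> 'a set set"
    and RII :: "nat \<Rightarrow> 'a \<times> 'a set \<times> 'b set \<Rightarrow> 'b"
  assumes RI: "\<And>n. RI n \<in> \<B> \<rightarrow> Pow \<A>"
    and RII: "\<And>n. RII n \<in> (\<Union>\<A>) \<times> \<A> \<times> \<B> \<rightarrow> \<Union>\<B>"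
    and R1: "\<And>n B. B \<in> \<B> \<Longrightarrow> RI n B \<noteq> {}"
    and R2: "\<And>n B A x. B \<in> \<B> \<Longrightarrow> A \<in> RI n B \<Longrightarrow> x \<in> A \<Longrightarrow> RII n (x, A, B) \<in> B"
    and R3: "\<And>(B :: nat \<Rightarrow> 'b set) (A :: nat \<Rightarrow> 'a set) (F :: nat \<Rightarrow> 'a set).
      (\<And>n. B n \<in> \<B> \<and> A n \<in> RI n (B n) \<and> finite (F n) \<and> F n \<subseteq> A n) \<Longrightarrow>
      (\<Union>n. F n) \<in> \<C> \<Longrightarrow> {RII n (x, A n, B n) | n x. x \<in> F n} \<in> \<D>"
  shows "G_1 \<A> \<C> \<le>\<^sub>I\<^sub>I G_1 \<B> \<D> \<and> G_fin \<A> \<C> \<le>\<^sub>I\<^sub>I G_fin \<B> \<D> \<and>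
    ((\<forall>n. \<forall>B\<in>\<B>. RI 1 B = RI n B) \<longrightarrow>
      G_1 \<A> \<C> \<le>\<^sub>I\<^sub>I\<^sup>+ G_1 \<B> \<D> \<and> G_fin \<A> \<C> \<le>\<^sub>I\<^sub>I\<^sup>+ G_fin \<B> \<D>)"
proof -
  \<comment> \<open>The choice depends only on the set \<open>RI n B\<close>, so equal sets in
    different rounds give the same move.\<close>
  define r where "r n B = (SOME A. A \<in> RI n B)" for n B
  have r: "r n B \<in> RI n B" if "B \<in> \<B>" for n B
    using R1[OF that, of n] unfolding r_def by (simp add: some_in_eq)
  have rA: "r n B \<in> \<A>" if "B \<in> \<B>" for n B
    using RI[of n] r[OF that, of n] that by auto
  interpret single: game_translation "G_1 \<A> \<C>" "G_1 \<B> \<D>" r "\<lambda>n B x. RII n (x, r n B, B)"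
  proof
    fix b :: "nat \<Rightarrow> 'b set" and y :: "nat \<Rightarrow> 'a"
    assume b: "\<And>n. b n \<in> One_moves (G_1 \<B> \<D>)"
      and y: "\<And>n. y n \<in> replies (G_1 \<A> \<C>) (r n (b n))" "y \<in> Two_wins (G_1 \<A> \<C>)"
    \<comment> \<open>A single selection is treated as the finite selection \<open>{y n}\<close>, so
      that \<open>R3\<close> covers this game too.\<close>
    have "{RII n (x, r n (b n), b n) | n x. x \<in> {y n}} \<in> \<D>"
    proof (rule R3)
      have "(\<Union>n. {y n}) = range y"
        by auto
      with y(2) show "(\<Union>n. {y n}) \<in> \<C>"
        by (simp add: G_1_def)
    qed (use b y(1) r in \<open>auto simp: G_1_def\<close>)
    also have "{RII n (x, r n (b n), b n) | n x. x \<in> {y n}} = range (\<lambda>n. RII n (y n, r n (b n), b n))"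
      by auto
    finally show "(\<lambda>n. RII n (y n, r n (b n), b n)) \<in> Two_wins (G_1 \<B> \<D>)"
      by (simp add: G_1_def)
  qed (use rA r R2 in \<open>auto simp: G_1_def\<close>)
  interpret finite: game_translation "G_fin \<A> \<C>" "G_fin \<B> \<D>" r
    "\<lambda>n B F. (\<lambda>x. RII n (x, r n B, B)) ` F"
  proof
    fix b :: "nat \<Rightarrow> 'b set" and F :: "nat \<Rightarrow> 'a set"
    assume b: "\<And>n. b n \<in> One_moves (G_fin \<B> \<D>)"
      and F: "\<And>n. F n \<in> replies (G_fin \<A> \<C>) (r n (b n))" "F \<in> Two_wins (G_fin \<A> \<C>)"
    have "{RII n (x, r n (b n), b n) | n x. x \<in> F n} \<in> \<D>"
      by (rule R3) (use b F r in \<open>auto simp: G_fin_def\<close>)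
    also have "{RII n (x, r n (b n), b n) | n x. x \<in> F n} =
        (\<Union>n. (\<lambda>x. RII n (x, r n (b n), b n)) ` F n)"
      by auto
    finally show "(\<lambda>n. (\<lambda>x. RII n (x, r n (b n), b n)) ` F n) \<in> Two_wins (G_fin \<B> \<D>)"
      by (simp add: G_fin_def)
  next
    fix B :: "'b set" and F :: "'a set" and n
    assume "B \<in> One_moves (G_fin \<B> \<D>)" "F \<in> replies (G_fin \<A> \<C>) (r n B)"
    then have "B \<in> \<B>" "finite F" "F \<subseteq> r n B"
      by (auto simp: G_fin_def)
    then show "(\<lambda>x. RII n (x, r n B, B)) ` F \<in> replies (G_fin \<B> \<D>) B"
      using R2 r by (auto simp: G_fin_def)
  qed (use rA in \<open>auto simp: G_fin_def\<close>)
  have const: "r n B = r 0 B" if "\<forall>n. \<forall>B\<in>\<B>. RI 1 B = RI n B" "B \<in> \<B>" for n B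
  proof -
    \<comment> \<open>Both sides equal \<open>RI 1 B\<close>: the hypothesis compares with round 1,
      \<open>le_II_plus\<close> with round 0.\<close>
    have "RI n B = RI 0 B"
      using that by metis
    then show ?thesis
      by (simp add: r_def)
  qed
  have "G_1 \<A> \<C> \<le>\<^sub>I\<^sub>I\<^sup>+ G_1 \<B> \<D> \<and> G_fin \<A> \<C> \<le>\<^sub>I\<^sub>I\<^sup>+ G_fin \<B> \<D>"
    if RI_const: "\<forall>n. \<forall>B\<in>\<B>. RI 1 B = RI n B"
    by (intro conjI single.le_II_plus finite.le_II_plus const[OF RI_const])
      (simp_all add: G_1_def G_fin_def)
  with single.le_II finite.le_II show ?thesis
    by blast
qed

end
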